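(* Let $\mathcal{E}, f, S, A, b, \mathrm{Feas}, \bar e, f^*, \bar D, \hat f, \hat r$ be as in the context, let $0<\epsilon<1$, and let $\{x_k'\}_{k\ge 0}$ be the feasible sequence generated by Algorithm A (described in the context) with input $\epsilon,\bar e,\hat f$. Then $$\ell \;\ge\; 8\left(\frac{\bar D}{\hat r}\right)^2\left(\frac{1}{\epsilon^2}+\frac1\epsilon\,\log_{4/3}\Big(1+\frac{\bar D}{\hat r}\Big)\right)\quad\Longrightarrow\quad \min_{k\le \ell}\frac{f(x_k')-f^*}{\hat f-f^*}\;\le\;\epsilon .$$
   Context: **Problem.** $\mathcal{E}$ is a finite-dimensional real vector space with inner product $\langle\cdot,\cdot\rangle$ and associated norm $\|\cdot\|$. $f:\mathcal{E}\to(-\infty,\infty]$ is an extended-valued, lower-semicontinuous convex function, $\mathrm{dom}(f)=\{x: f(x)<\infty\}$, $\mathrm{epi}(f)=\{(x,t)\in\mathcal E\times\mathbb R: x\in\mathrm{dom}(f),\ t\ge f(x)\}$. $S\subseteq\mathcal{E}$ is a closed convex set with nonempty interior, $A$ is a linear operator on $\mathcal E$, $b$ is a vector in its range space, and $\mathrm{Feas}=\{x\in S: Ax=b\}$. The problem is $\min f(x)$ s.t. $x\in\mathrm{Feas}$. The point $\bar e\in\mathrm{int}(S\cap\mathrm{dom}(f))$ is known and satisfies $A\bar e=b$. $\bar D$ is the diameter (supremum of distances between pairs of points) of $\{x\in\mathrm{Feas}: f(x)\le f(\bar e)\}$ and is assumed finite; hence the optimal value $f^*$ is attained. $\hat f$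 is a user-chosen real number with $\hat f>f(\bar e)$, and $$\hat r:=\sup\{r : \|x-\bar e\|\le r \text{ and } Ax=b\ \Rightarrow\ x\in S\text{ and } f(x)\le\hat f\},$$ which is positive. **Line search.** For $x\in\mathcal E$, $t\in\mathbb R$ and scalars $\alpha$ let $x(\alpha)=\bar e+\alpha(x-\bar e)$, $t(\alpha)=\hat f+\alpha(t-\hat f)$; $\alpha_1(x)=\sup\{\alpha: x(\alpha)\in S\}$, $\alpha_2(x,t)=\sup\{\alpha: f(x(\alpha))\le t(\alpha)\}$, $\alpha(x,t)=\min\{\alpha_1(x),\alpha_2(x,t)\}$ (positive and finite whenever $Ax=b$ and $t<\hat f$). For such $(x,t)$, let $\pi'(x,t)=(\bar e,\hat f)+\alpha(x,t)\cdot((x,t)-(\bar e,\hat f))$. **The sets $G$.** $N_C(p)=\{v:\langle v,q-p\rangle\le0\ \forall q\in C\}$ denotes the normal cone to $C$ at $p$; on $\mathcal E\times\mathbb R$ the inner product assigning $(x_1,t_1),(x_2,t_2)$ the value $\langle x_1,x_2\rangle+t_1t_2$ is used. $\mathrm{bdy}$ denotes boundary. For $x'\in\mathrm{bdy}(S)$, $$G_1(x')=\Big\{\tfrac{-1}{\langle v,\bar e-x'\rangle}v : 0\ne v\in N_S(x')\Big\};$$ for $(x',t')\in\mathrm{bdy}(\mathrm{epi}(f))$, $$G_2(x',t')=\Big\{\tfrac{-1}{\langle v,\bar e-x'\rangle+(\hat f-t')\delta}v : (0,0)\ne(v,\delta)\in N_{\mathrm{epi}(f)}(x',t')\Big\}.$$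 With $\mathrm{bdy}_1=\{(x',t'):x'\in\mathrm{bdy}(S)\}$ and $\mathrm{bdy}_2=\mathrm{bdy}(\mathrm{epi}(f))$, let $G(x',t')=G_1(x')$ if $(x',t')\in\mathrm{bdy}_1\setminus\mathrm{bdy}_2$; $G(x',t')=G_2(x',t')$ if $(x',t')\in\mathrm{bdy}_2\setminus\mathrm{bdy}_1$; and $G(x',t')$ is the convex hull of $G_1(x')\cup G_2(x',t')$ if $(x',t')\in\mathrm{bdy}_1\cap\mathrm{bdy}_2$. $P$ denotes orthogonal projection onto the kernel of $A$. **Algorithm A.** Input: $0<\epsilon<1$, $\bar e$, $\hat f$. Initialize $(x_0,t_0)=(\bar e,f(\bar e))$ and $(x_0',t_0')=(\bar e,f(\bar e))$. Iterate for $k=0,1,2,\dots$: - Compute $\tilde x_{k+1}=x_k-\frac{\epsilon}{2\|P(g')\|^2}P(g')$, where $g'\in G(x_k',t_k')$. - Let $\alpha_{k+1}=\alpha(\tilde x_{k+1},t_k)$ and $(x_{k+1}',t_{k+1}')=\pi'(\tilde x_{k+1},t_k)$. - If $\alpha_{k+1}\ge4/3$, let $(x_{k+1},t_{k+1})=(x_{k+1}',t_{k+1}')$; else let $(x_{k+1},t_{k+1})=(\tilde x_{k+1},t_k)$. *)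

theory Defs
  imports "HOL-Analysis.Analysis"
begin

section \<open>Extended-valued convex functions and the optimization problem\<close>

definition ext_convex :: "('a::real_vector \<Rightarrow> ereal) \<Rightarrow> bool" where
  "ext_convex f \<longleftrightarrow>
     (\<forall>x y. \<forall>u\<ge>0. \<forall>v\<ge>0. u + v = 1 \<longrightarrow>
        f (u *\<^sub>R x + v *\<^sub>R y) \<le> ereal u * f x + ereal v * f y)"

definition ext_lsc :: "('a::topological_space \<Rightarrow> ereal) \<Rightarrow> bool" where
  "ext_lsc f \<longleftrightarrow> (\<forall>x. f x \<le> Liminf (at x) f)"

definition dom :: "('a \<Rightarrow> ereal) \<Rightarrow> 'a set" where
  "dom f = {x. f x < \<infinity>}"

definition epi :: "('a \<Rightarrow> ereal) \<Rightarrow> ('a \<times> real) set" where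
  "epi f = {(x, t). x \<in> dom f \<and> ereal t \<ge> f x}"

definition Feas :: "'a set \<Rightarrow> ('a \<Rightarrow> 'b) \<Rightarrow> 'b \<Rightarrow> 'a set" where
  "Feas S A b = {x \<in> S. A x = b}"

definition opt_value :: "('a \<Rightarrow> ereal) \<Rightarrow> 'a set \<Rightarrow> ('a \<Rightarrow> 'b) \<Rightarrow> 'b \<Rightarrow> ereal" where
  "opt_value f S A b = (INF x\<in>Feas S A b. f x)"

definition level_set ::
  "('a \<Rightarrow> ereal) \<Rightarrow> 'a set \<Rightarrow> ('a \<Rightarrow> 'b) \<Rightarrow> 'b \<Rightarrow> 'a \<Rightarrow> 'a set" where
  "level_set f S A b ebar = {x \<in> Feas S A b. f x \<le> f ebar}"

text \<open>The supremum is taken in \<^typ>\<open>ereal\<close>; under the standing assumptions it is infinite exactly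
  when the kernel of \<open>A\<close> is trivial.\<close>

definition rhat ::
  "('a::real_normed_vector \<Rightarrow> ereal) \<Rightarrow> 'a set \<Rightarrow> ('a \<Rightarrow> 'b) \<Rightarrow> 'b \<Rightarrow> 'a \<Rightarrow> real \<Rightarrow> ereal" where
  "rhat f S A b ebar fhat =
     Sup {ereal r | r. \<forall>x. norm (x - ebar) \<le> r \<and> A x = b \<longrightarrow> x \<in> S \<and> f x \<le> ereal fhat}"

section \<open>The line search\<close>

definition alpha1 :: "'a::real_vector set \<Rightarrow> 'a \<Rightarrow> 'a \<Rightarrow> ereal" where
  "alpha1 S ebar x = Sup {ereal a | a. ebar + a *\<^sub>R (x - ebar) \<in> S}"

definition alpha2 :: "('a::real_vector \<Rightarrow> ereal) \<Rightarrow> 'a \<Rightarrow> real \<Rightarrow> 'a \<Rightarrow> real \<Rightarrow> ereal" where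
  "alpha2 f ebar fhat x t =
     Sup {ereal a | a. f (ebar + a *\<^sub>R (x - ebar)) \<le> ereal (fhat + a * (t - fhat))}"

text \<open>Only one of the two suprema need be finite. The minimum is finite and positive whenever
  \<open>A x = b\<close> and \<open>t < fhat\<close>, so that \<^const>\<open>real_of_ereal\<close> then loses nothing.\<close>

definition alpha ::
  "('a::real_vector \<Rightarrow> ereal) \<Rightarrow> 'a set \<Rightarrow> 'a \<Rightarrow> real \<Rightarrow> 'a \<Rightarrow> real \<Rightarrow> real" where
  "alpha f S ebar fhat x t = real_of_ereal (min (alpha1 S ebar x) (alpha2 f ebar fhat x t))"

definition pi' ::
  "('a::real_vector \<Rightarrow> ereal) \<Rightarrow> 'a set \<Rightarrow> 'a \<Rightarrow> real \<Rightarrow> 'a \<Rightarrow> real \<Rightarrow> 'a \<times> real" where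
  "pi' f S ebar fhat x t =
     (ebar, fhat) + alpha f S ebar fhat x t *\<^sub>R ((x, t) - (ebar, fhat))"

section \<open>Normal cones and the sets \<open>G\<close>\<close>

definition normal_cone :: "'a::real_inner set \<Rightarrow> 'a \<Rightarrow> 'a set" where
  "normal_cone C p = {v. \<forall>q\<in>C. v \<bullet> (q - p) \<le> 0}"

definition G1 :: "'a::real_inner set \<Rightarrow> 'a \<Rightarrow> 'a \<Rightarrow> 'a set" where
  "G1 S ebar x' = {(- 1 / (v \<bullet> (ebar - x'))) *\<^sub>R v | v. v \<noteq> 0 \<and> v \<in> normal_cone S x'}"

definition G2 :: "('a::real_inner \<Rightarrow> ereal) \<Rightarrow> 'a \<Rightarrow> real \<Rightarrow> 'a \<Rightarrow> real \<Rightarrow> 'a set" where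
  "G2 f ebar fhat x' t' =
     {(- 1 / (v \<bullet> (ebar - x') + (fhat - t') * d)) *\<^sub>R v | v d.
        (v, d) \<noteq> (0, 0) \<and> (v, d) \<in> normal_cone (epi f) (x', t')}"

definition bdy1 :: "'a::topological_space set \<Rightarrow> ('a \<times> real) set" where
  "bdy1 S = {(x', t'). x' \<in> frontier S}"

definition bdy2 :: "('a::topological_space \<Rightarrow> ereal) \<Rightarrow> ('a \<times> real) set" where
  "bdy2 f = frontier (epi f)"

text \<open>The value \<open>{}\<close> off \<open>bdy1 S \<union> bdy2 f\<close> is arbitrary: the points \<open>(x'\<^sub>k, t'\<^sub>k)\<close> produced by the
  algorithm always lie in this union.\<close>

definition G ::
  "('a::real_inner \<Rightarrow> ereal) \<Rightarrow> 'a set \<Rightarrow> 'a \<Rightarrow> real \<Rightarrow> 'a \<Rightarrow> real \<Rightarrow> 'a set" where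
  "G f S ebar fhat x' t' =
     (if (x', t') \<in> bdy1 S - bdy2 f then G1 S ebar x'
      else if (x', t') \<in> bdy2 f - bdy1 S then G2 f ebar fhat x' t'
      else if (x', t') \<in> bdy1 S \<inter> bdy2 f then convex hull (G1 S ebar x' \<union> G2 f ebar fhat x' t')
      else {})"

definition orth_proj :: "'a::real_inner set \<Rightarrow> 'a \<Rightarrow> 'a" where
  "orth_proj L x = (THE y. y \<in> L \<and> (\<forall>z\<in>L. (x - y) \<bullet> z = 0))"

definition proj_ker :: "('a::real_inner \<Rightarrow> 'b::zero) \<Rightarrow> 'a \<Rightarrow> 'a" where
  "proj_ker A = orth_proj {x. A x = 0}"

section \<open>Algorithm A\<close>

text \<open>\<open>algorithm_A f S A ebar fhat eps x t x' t'\<close> states that \<open>(x\<^sub>k, t\<^sub>k)\<close> and \<open>(x'\<^sub>k, t'\<^sub>k)\<close> form a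
  possible run; the choice of \<open>g \<in> G (x'\<^sub>k, t'\<^sub>k)\<close> is free at each step. If \<open>P g = 0\<close>, the point
  \<open>x'\<^sub>k\<close> is already optimal and the step is undefined on paper; here, as \<open>c / 0 = 0\<close>,
  it leaves \<open>x\<^sub>k\<close> where it is.\<close>

definition algorithm_A ::
  "('a::real_inner \<Rightarrow> ereal) \<Rightarrow> 'a set \<Rightarrow> ('a \<Rightarrow> 'b::zero) \<Rightarrow> 'a \<Rightarrow> real \<Rightarrow> real \<Rightarrow>
   (nat \<Rightarrow> 'a) \<Rightarrow> (nat \<Rightarrow> real) \<Rightarrow> (nat \<Rightarrow> 'a) \<Rightarrow> (nat \<Rightarrow> real) \<Rightarrow> bool" where
  "algorithm_A f S A ebar fhat eps x t x' t' \<longleftrightarrow>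
     (x 0, t 0) = (ebar, real_of_ereal (f ebar)) \<and>
     (x' 0, t' 0) = (ebar, real_of_ereal (f ebar)) \<and>
     (\<forall>k. \<exists>g \<in> G f S ebar fhat (x' k) (t' k).
        let Pg = proj_ker A g;
            xt = x k - (eps / (2 * (norm Pg)\<^sup>2)) *\<^sub>R Pg;
            a = alpha f S ebar fhat xt (t k)
        in (x' (Suc k), t' (Suc k)) = pi' f S ebar fhat xt (t k) \<and>
           (x (Suc k), t (Suc k)) =
             (if a \<ge> 4 / 3 then (x' (Suc k), t' (Suc k)) else (xt, t k)))"

end

theory Submission
  imports Defs
begin

text \<open>Let \<open>C\<close> be the set of \<open>(y, s)\<close> with \<open>y \<in> S\<close> and \<open>f y \<le> s\<close>, and consider its gauge seen from the
  interior point \<open>(ebar, fhat)\<close>. Along the ray through \<open>(x, t)\<close> the gauge is \<open>1 / \<alpha>(x, t)\<close>, and the elements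
  of \<open>G\<close> are the \<open>x\<close>-parts of its subgradients; as the gauge is at most \<open>1\<close> on the slice of radius \<open>r\<close>
  at height \<open>fhat\<close>, projected subgradients have norm at most \<open>1 / r\<close>.
  Let \<open>p\<close> be a nearly optimal feasible point of value \<open>c\<close>. While the height \<open>t\<close> is fixed, compare \<open>x\<^sub>k\<close> with the
  point \<open>y\<close> of height \<open>t\<close> on the segment from \<open>(ebar, fhat)\<close> to \<open>(p, c)\<close>, whose gauge is at most
  \<open>\<beta> = (fhat - t) / (fhat - c)\<close>. If \<open>x'\<^sub>k\<close> is not yet \<open>\<epsilon>\<close>-good, the gauge gap \<open>1 / \<alpha> - \<beta>\<close> is at
  least \<open>3\<epsilon> / 4\<close> (and at least \<open>1 / 4\<close> if \<open>\<beta> \<le> 1 / 2\<close>), so each step lowers the squared distance to \<open>y\<close>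
  by \<open>\<epsilon>\<^sup>2 r\<^sup>2 / 2\<close> (respectively \<open>\<epsilon> r\<^sup>2 / 6\<close>). This distance is at most the diameter after each restart, and
  each restart multiplies \<open>\<beta>\<close>, which is initially at least \<open>1 / (1 + D / r)\<close> and stays below \<open>1\<close>, by at least \<open>4 / 3\<close>.\<close>

section \<open>Convex sets, epigraphs and projections\<close>

text \<open>A small move from \<open>e\<close> in the direction \<open>n\<close> stays in
  \<open>K\<close> but raises the product with \<open>n\<close>, so the inequality at
  \<open>e\<close> is strict. Hence the denominators in \<open>G1\<close> and \<open>G2\<close> are
  negative.\<close>

lemma normal_cone_interior_neg:
  assumes "e \<in> interior K" "n \<in> normal_cone K p" "n \<noteq> 0"
  shows "n \<bullet> (e - p) < 0"
proof -
  obtain d where d: "d > 0" "cball e d \<subseteq> K"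
    using assms(1) mem_interior_cball by blast
  define q where "q = e + (d / norm n) *\<^sub>R n"
  have "q \<in> K" using d assms(3) by (auto simp: q_def dist_norm intro!: subsetD[OF d(2)])
  then have "n \<bullet> (q - p) \<le> 0" using assms(2) by (auto simp: normal_cone_def)
  moreover have "n \<bullet> (q - p) = n \<bullet> (e - p) + (d / norm n) * (n \<bullet> n)"
    by (simp add: q_def algebra_simps inner_add_right inner_diff_right)
  moreover have "(d / norm n) * (n \<bullet> n) > 0" using d assms(3) by simp
  ultimately show ?thesis by linarith
qed

lemma convex_epi:
  assumes "ext_convex f" shows "convex (epi f)"
proof (rule convexI)
  fix p q :: "'a \<times> real" and u v :: real
  assume p: "p \<in> epi f" and q: "q \<in> epi f" and uv: "0 \<le> u" "0 \<le> v" "u + v = 1"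
  obtain x s y t where [simp]: "p = (x, s)" "q = (y, t)" by (cases p, cases q)
  have "f (u *\<^sub>R x + v *\<^sub>R y) \<le> ereal u * f x + ereal v * f y"
    using assms uv unfolding ext_convex_def by blast
  also have "\<dots> \<le> ereal u * ereal s + ereal v * ereal t"
    using p q uv by (intro add_mono ereal_mult_left_mono) (auto simp: epi_def)
  finally have "f (u *\<^sub>R x + v *\<^sub>R y) \<le> ereal (u * s + v * t)" by simp
  moreover from this have "f (u *\<^sub>R x + v *\<^sub>R y) < \<infinity>" by (auto simp: less_top[symmetric])
  ultimately show "u *\<^sub>R p + v *\<^sub>R q \<in> epi f" by (simp add: epi_def dom_def)
qed

lemma mem_epi_iff: "(y, s) \<in> epi f \<longleftrightarrow> f y \<le> ereal s"
  by (auto simp: epi_def dom_def less_top[symmetric])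

lemma closed_epi:
  fixes f :: "'a::metric_space \<Rightarrow> ereal"
  assumes "ext_lsc f" shows "closed (epi f)"
proof (unfold closed_sequential_limits, intro allI impI, elim conjE)
  fix z l assume z: "\<forall>n. z n \<in> epi f" and lim: "z \<longlonglongrightarrow> l"
  obtain x t where [simp]: "l = (x, t)" by (cases l)
  have zx: "(\<lambda>n. fst (z n)) \<longlonglongrightarrow> x" and zt: "(\<lambda>n. snd (z n)) \<longlonglongrightarrow> t"
    using tendsto_fst[OF lim] tendsto_snd[OF lim] by auto
  have le: "f (fst (z n)) \<le> ereal (snd (z n))" for n
    using z[rule_format, of n] mem_epi_iff[of "fst (z n)" "snd (z n)" f] by simp
  have "f x \<le> ereal t"
  proof (rule ccontr)
    assume "\<not> f x \<le> ereal t"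
    then obtain s where s: "ereal t < ereal s" "ereal s < f x" using ereal_dense2 by (metis not_le)
    have "ereal s < Liminf (at x) f" using assms s(2) unfolding ext_lsc_def by (meson less_le_trans)
    then have "\<forall>\<^sub>F y in at x. ereal s < f y" by (rule less_LiminfD)
    \<comment> \<open>\<open>at x\<close> leaves out \<open>x\<close>, which the sequence may hit;
      \<open>s < f x\<close> covers it.\<close>
    then have "\<forall>\<^sub>F y in nhds x. ereal s < f y"
      using s(2) by (auto simp: eventually_at_filter elim: eventually_mono)
    then have "\<forall>\<^sub>F n in sequentially. ereal s < f (fst (z n))"
      using zx unfolding filterlim_iff by blast
    then have "\<forall>\<^sub>F n in sequentially. s \<le> snd (z n)"
      by eventually_elim (metis le ereal_less_eq(3) less_le_trans less_imp_le)
    then have "s \<le> t" by (intro tendsto_lowerbound[OF zt]) auto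
    with s(1) show False by simp
  qed
  then show "l \<in> epi f" by (simp add: mem_epi_iff)
qed

text \<open>A finite convex function on an open ball is continuous, so \<open>f\<close> stays below
  some \<open>m < s\<close> near \<open>e\<close>, and everything above \<open>m\<close> there lies
  in the epigraph.\<close>

lemma mem_interior_epi:
  fixes f :: "'a::euclidean_space \<Rightarrow> ereal"
  assumes proper: "\<And>y. f y \<noteq> - \<infinity>" and cvx: "ext_convex f"
    and e: "e \<in> interior (dom f)" and s: "f e < ereal s"
  shows "(e, s) \<in> interior (epi f)"
proof -
  obtain d where d: "d > 0" "ball e d \<subseteq> dom f" using e mem_interior by blast
  define h where "h y = real_of_ereal (f y)" for y
  have fh: "f y = ereal (h y)" if "y \<in> ball e d" for y
    using proper[of y] d that by (cases "f y") (auto simp: h_def dom_def)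
  have "convex_on (ball e d) h"
  proof (intro convex_onI convex_ball)
    fix u :: real and x y assume u: "0 < u" "u < 1" and xy: "x \<in> ball e d" "y \<in> ball e d"
    have m: "(1 - u) *\<^sub>R x + u *\<^sub>R y \<in> ball e d"
      using convex_ball[of e d] xy u by (intro convexD) auto
    have "f ((1 - u) *\<^sub>R x + u *\<^sub>R y) \<le> ereal (1 - u) * f x + ereal u * f y"
      using cvx u unfolding ext_convex_def by force
    then show "h ((1 - u) *\<^sub>R x + u *\<^sub>R y) \<le> (1 - u) * h x + u * h y"
      unfolding fh[OF m] fh[OF xy(1)] fh[OF xy(2)] by simp
  qed
  then have "continuous_on (ball e d) h" by (intro convex_on_continuous) auto
  then have c: "isCont h e" using d by (simp add: continuous_on_eq_continuous_at)
  have "h e < s" using s fh d by simp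
  then obtain m where m: "h e < m" "m < s" using dense by blast
  have "\<forall>\<^sub>F y in nhds e. h y < m"
    using c m(1) by (intro order_tendstoD(2)) (auto simp: isCont_def tendsto_at_iff_tendsto_nhds)
  moreover have "\<forall>\<^sub>F y in nhds e. y \<in> ball e d" using d by (intro eventually_nhds_in_open) auto
  ultimately have "\<forall>\<^sub>F y in nhds e. f y \<le> ereal m" by eventually_elim (simp add: fh)
  then obtain U where U: "open U" "e \<in> U" "\<And>y. y \<in> U \<Longrightarrow> f y \<le> ereal m"
    unfolding eventually_nhds by blast
  have "f y \<le> ereal u" if "y \<in> U" "m < u" for y u
    using order_trans[OF U(3)[OF that(1)], of "ereal u"] that(2) by simp
  then have "U \<times> {m<..} \<subseteq> epi f" by (auto simp: mem_epi_iff)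
  then show ?thesis using U m by (intro interiorI[of "U \<times> {m<..}"]) (auto intro: open_Times)
qed

text \<open>The \<open>THE\<close> in \<open>orth_proj\<close> is legitimate: two candidates differ
  by a vector of \<open>L\<close> that is orthogonal to itself.\<close>

lemma orth_proj_eq:
  fixes L :: "'a::euclidean_space set"
  assumes "subspace L"
  shows "orth_proj L v \<in> L" "\<And>z. z \<in> L \<Longrightarrow> (v - orth_proj L v) \<bullet> z = 0"
proof -
  obtain y w where yw: "y \<in> span L" "\<And>z. z \<in> span L \<Longrightarrow> orthogonal w z" "v = y + w"
    using orthogonal_subspace_decomp_exists[of L v] by blast
  have sp: "span L = L" using assms by (simp add: span_eq_iff)
  have ex: "y \<in> L \<and> (\<forall>z\<in>L. (v - y) \<bullet> z = 0)" using yw sp by (auto simp: orthogonal_def)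
  have "y' = y" if "y' \<in> L \<and> (\<forall>z\<in>L. (v - y') \<bullet> z = 0)" for y'
  proof -
    have "y' - y \<in> L" using that ex assms by (simp add: subspace_diff)
    then have "(v - y) \<bullet> (y' - y) = 0" "(v - y') \<bullet> (y' - y) = 0" using that ex by auto
    then have "(y' - y) \<bullet> (y' - y) = 0" by (simp add: inner_diff_left)
    then show ?thesis by simp
  qed
  then have eq: "orth_proj L v = y" unfolding orth_proj_def using ex by (rule the_equality[rotated])
  show "orth_proj L v \<in> L" using ex unfolding eq by blast
  show "\<And>z. z \<in> L \<Longrightarrow> (v - orth_proj L v) \<bullet> z = 0" using ex unfolding eq by blast
qed

text \<open>Parameters below \<open>a\<close> lie under an attained one, so convexity puts them in
  \<open>K\<close>; closedness adds \<open>a\<close> itself. The supremum may be infinite.\<close>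

lemma ray_mem:
  fixes K :: "'a::real_normed_vector set"
  assumes K: "closed K" "convex K" "e \<in> K" and a: "0 \<le> a" "ereal a \<le> Sup {ereal a | a. e + a *\<^sub>R w \<in> K}"
  shows "e + a *\<^sub>R w \<in> K"
proof (cases "a = 0")
  case False
  have lt: "e + c *\<^sub>R w \<in> K" if c: "0 \<le> c" "c < a" for c
  proof -
    have "ereal c < Sup {ereal a | a. e + a *\<^sub>R w \<in> K}" using c a(2) by (meson ereal_less_eq less_le_trans less_ereal.simps(1))
    then obtain m where m: "c < m" "e + m *\<^sub>R w \<in> K" by (auto simp: less_Sup_iff)
    have "e + c *\<^sub>R w = (1 - c / m) *\<^sub>R e + (c / m) *\<^sub>R (e + m *\<^sub>R w)"
      using c m by (simp add: algebra_simps)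
    also have "\<dots> \<in> K" using c m K by (intro convexD) auto
    finally show ?thesis .
  qed
  have lim: "((\<lambda>c. e + c *\<^sub>R w) \<longlongrightarrow> e + a *\<^sub>R w) (at_left a)"
    by (intro tendsto_intros)
  have "\<forall>\<^sub>F c in at_left a. e + c *\<^sub>R w \<in> K"
    using eventually_at_left_real[of 0 a] False a(1) by (auto elim!: eventually_mono intro: lt)
  then show ?thesis using Lim_in_closed_set[OF K(1) _ _ lim] by simp
qed (use K in simp)

lemma ray_interior:
  fixes K :: "'a::real_normed_vector set"
  assumes "e \<in> interior K"
  shows "\<exists>a>0. e + a *\<^sub>R w \<in> K"
proof -
  obtain d where d: "d > 0" "cball e d \<subseteq> K"
    using assms mem_interior_cball by blast
  \<comment> \<open>The summand 1 keeps the divisor positive when \<open>w = 0\<close>.\<close>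
  define n where "n = 1 + norm w"
  have n: "0 < n" "norm w \<le> n" using norm_ge_zero[of w] unfolding n_def by linarith+
  have "d / n * norm w \<le> d / n * n" using d n by (intro mult_left_mono) auto
  then have "d / n * norm w \<le> d" using n by simp
  then have "e + (d / n) *\<^sub>R w \<in> cball e d" using d n by (simp add: dist_norm)
  moreover have "d / n > 0" using d n by simp
  ultimately show ?thesis using d(2) by blast
qed

section \<open>Counting the iterations\<close>

text \<open>\<open>d k\<close> and \<open>d' k\<close> are the squared distances to the comparison point before and after the
  subgradient step \<open>k\<close>; a restart multiplies \<open>\<beta>\<close> by at least \<open>4/3\<close>. Since \<open>(4/3)\<^sup>3 > 2\<close>, at most three
  stages have \<open>\<beta> > 1/2\<close>, and only those pay the larger price \<open>\<kappa>2\<close>.\<close>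

lemma stage_count:
  fixes \<beta> d d' :: "nat \<Rightarrow> real" and M \<kappa>1 \<kappa>2 :: real
  assumes pos: "0 \<le> M" "0 < \<kappa>1" "0 < \<kappa>2"
    and \<beta>0: "0 < \<beta> 0" and \<beta>1: "\<And>k. k \<le> l \<Longrightarrow> \<beta> k < 1"
    and d0: "d 0 \<le> M" and d': "\<And>k. k \<le> l \<Longrightarrow> 0 \<le> d' k"
    and low: "\<And>k. k \<le> l \<Longrightarrow> \<beta> k \<le> 1/2 \<Longrightarrow> 1 \<le> \<kappa>1 * (d k - d' k)"
    and high: "\<And>k. k \<le> l \<Longrightarrow> 1 \<le> \<kappa>2 * (d k - d' k)"
    and advance: "\<And>k. k < l \<Longrightarrow> (\<beta> (Suc k) = \<beta> k \<and> d (Suc k) = d' k) \<or>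
           (4/3 * \<beta> k \<le> \<beta> (Suc k) \<and> d (Suc k) \<le> M)"
  shows "real (Suc l) \<le> M * (\<kappa>1 * log (4/3) (1 / \<beta> 0) + 3 * \<kappa>2)"
proof -
  define stage where "stage v k N h D \<longleftrightarrow>
     (v \<le> 1/2 \<and> h = 0 \<and> \<beta> 0 * (4/3)^N \<le> v \<and> k \<le> \<kappa>1 * M * real N + \<kappa>1 * (M - D)) \<or>
     (1/2 < v \<and> (N = 0 \<or> \<beta> 0 * (4/3)^(N - 1) \<le> 1/2) \<and> 1/2 * (4/3)^h \<le> v \<and>
       k \<le> \<kappa>1 * M * real N + \<kappa>2 * M * real h + \<kappa>2 * (M - D))"
    for v k D :: real and N h :: nat
  \<comment> \<open>\<open>N\<close> and \<open>h\<close> count the completed stages with \<open>\<beta> \<le> 1/2\<close> and \<open>\<beta> > 1/2\<close>.\<close>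
  have half: "stage (\<beta> k) (real (Suc k)) N h (d' k)" if "k \<le> l" "stage (\<beta> k) (real k) N h (d k)" for k N h
    using that low[OF that(1)] high[OF that(1)] unfolding stage_def by (auto simp: algebra_simps)
  have main: "\<exists>N h. stage (\<beta> k) (real k) N h (d k)" if "k \<le> l" for k
    using that
  proof (induction k)
    case 0
    show ?case
      by (rule exI[of _ 0], rule exI[of _ 0]) (use pos d0 in \<open>auto simp: stage_def\<close>)
  next
    case (Suc k)
    then obtain N h where "stage (\<beta> k) (real k) N h (d k)" by auto
    then have st: "stage (\<beta> k) (real (Suc k)) N h (d' k)" using half Suc.prems by simp
    consider "\<beta> (Suc k) = \<beta> k" "d (Suc k) = d' k" | "4/3 * \<beta> k \<le> \<beta> (Suc k)" "d (Suc k) \<le> M"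
      using advance[of k] Suc.prems by auto
    then show ?case
    proof cases
      case 1
      then show ?thesis using st by auto
    next
      case 2
      have nn: "0 \<le> d' k" using d' Suc.prems by simp
      have pn: "0 \<le> \<kappa>1 * d' k" "0 \<le> \<kappa>2 * d' k" "0 \<le> \<kappa>1 * (M - d (Suc k))" "0 \<le> \<kappa>2 * (M - d (Suc k))"
        using nn pos 2 by auto
      from st consider
        (a) "\<beta> k \<le> 1/2" "h = 0" "\<beta> 0 * (4/3)^N \<le> \<beta> k" "real (Suc k) \<le> \<kappa>1 * M * real N + \<kappa>1 * (M - d' k)"
        | (b) "1/2 < \<beta> k" "N = 0 \<or> \<beta> 0 * (4/3)^(N - 1) \<le> 1/2" "1/2 * (4/3)^h \<le> \<beta> k"
           "real (Suc k) \<le> \<kappa>1 * M * real N + \<kappa>2 * M * real h + \<kappa>2 * (M - d' k)"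
        unfolding stage_def by blast
      then show ?thesis
      proof cases
        case a
        \<comment> \<open>As \<open>0 \<le> d' k\<close>, a closed low stage costs at most
          \<open>\<kappa>1 * M\<close>. If the next stage is high, the fact that this one was low
          survives as the bound with exponent \<open>N - 1\<close>.\<close>
        have k: "real (Suc k) \<le> \<kappa>1 * M * real (Suc N)" using a(4) pn by (simp add: algebra_simps)
        have "stage (\<beta> (Suc k)) (real (Suc k)) (Suc N) 0 (d (Suc k))"
          using k a 2 pn unfolding stage_def by auto
        then show ?thesis by blast
      next
        case b
        have k: "real (Suc k) \<le> \<kappa>1 * M * real N + \<kappa>2 * M * real (Suc h)"
          using b(4) pn by (simp add: algebra_simps)
        have "stage (\<beta> (Suc k)) (real (Suc k)) N (Suc h) (d (Suc k))"
          using k b 2 pn unfolding stage_def by auto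
        then show ?thesis by blast
      qed
    qed
  qed
  from main[of l] obtain N h where "stage (\<beta> l) (real l) N h (d l)" by auto
  then have fin: "stage (\<beta> l) (real (Suc l)) N h (d' l)" by (intro half) auto
  define L where "L = log (4/3) (1 / \<beta> 0)"
  have b01: "\<beta> 0 < 1" using \<beta>1 by simp
  have L0: "0 \<le> L" using \<beta>0 b01 by (simp add: L_def)
  \<comment> \<open>The gap between 1/2 and 1 has room for one more factor 4/3, so \<open>L\<close>
    also pays for an unfinished low stage.\<close>
  have pw: "real n + 1 \<le> L" if "\<beta> 0 * (4/3)^n \<le> 1/2" for n
  proof -
    have "(4/3::real)^(Suc n) \<le> 2 * (4/3)^n" by simp
    also have "\<dots> \<le> 1 / \<beta> 0" using that \<beta>0 by (simp add: field_simps)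
    finally have "log (4/3) ((4/3)^(Suc n)) \<le> L" unfolding L_def using \<beta>0 by (subst log_le_cancel_iff) auto
    moreover have "log (4/3) ((4/3::real)^(Suc n)) = real (Suc n)" by (subst log_nat_power) auto
    ultimately show ?thesis by linarith
  qed
  have dl: "0 \<le> d' l" using d' by simp
  then have pn: "0 \<le> \<kappa>1 * d' l" "0 \<le> \<kappa>2 * d' l" using pos by auto
  have mp: "0 \<le> \<kappa>1 * M" "0 \<le> \<kappa>2 * M" using pos by auto
  from fin[unfolded stage_def] have "real (Suc l) \<le> \<kappa>1 * M * L + \<kappa>2 * M * 3"
  proof
    assume *: "\<beta> l \<le> 1/2 \<and> h = 0 \<and> \<beta> 0 * (4/3)^N \<le> \<beta> l \<and> real (Suc l) \<le> \<kappa>1 * M * real N + \<kappa>1 * (M - d' l)"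
    then have "\<kappa>1 * M * (real N + 1) \<le> \<kappa>1 * M * L" using pw[of N] mp by (intro mult_left_mono) auto
    then show ?thesis using * pn mp by (simp add: algebra_simps)
  next
    assume *: "1/2 < \<beta> l \<and> (N = 0 \<or> \<beta> 0 * (4/3)^(N - 1) \<le> 1/2) \<and> 1/2 * (4/3)^h \<le> \<beta> l \<and>
       real (Suc l) \<le> \<kappa>1 * M * real N + \<kappa>2 * M * real h + \<kappa>2 * (M - d' l)"
    have "real N \<le> L" using * pw[of "N - 1"] L0 by (cases "N = 0") auto
    then have 1: "\<kappa>1 * M * real N \<le> \<kappa>1 * M * L" using mp by (intro mult_left_mono) auto
    \<comment> \<open>Two completed high stages and the current one account for the factor 3 of
      \<open>\<kappa>2\<close>.\<close>
    have "h \<le> 2"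
    proof (rule ccontr)
      assume "\<not> h \<le> 2"
      then have "(4/3::real)^3 \<le> (4/3)^h" by (intro power_increasing) auto
      then have "2 < (4/3::real)^h" by (simp add: power3_eq_cube)
      then show False using * \<beta>1[of l] by linarith
    qed
    then have "\<kappa>2 * M * real h \<le> \<kappa>2 * M * 2" using mp by (intro mult_left_mono) auto
    then show ?thesis using * 1 pn by (simp add: algebra_simps)
  qed
  then show ?thesis by (simp add: L_def algebra_simps)
qed

text \<open>Expanding the square gives the decrease
  \<open>\<epsilon> / (norm p)^2 * (p \<bullet> u - \<epsilon> / 4)\<close>. The last factor stays
  nonnegative with \<open>\<gamma>\<close> in place of \<open>p \<bullet> u\<close>, so
  \<open>1 / (norm p)^2\<close> may be replaced by the smaller \<open>r^2\<close>.\<close>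

lemma step_decrease:
  fixes u p :: "'a::real_inner"
  assumes eps: "0 < \<epsilon>" and r: "0 < r" "norm p * r \<le> 1" and gap: "\<gamma> \<le> p \<bullet> u" "3 * \<epsilon> / 4 \<le> \<gamma>"
  shows "(norm (u - (\<epsilon> / (2 * (norm p)\<^sup>2)) *\<^sub>R p))\<^sup>2 \<le> (norm u)\<^sup>2 - \<epsilon> * r\<^sup>2 * (\<gamma> - \<epsilon> / 4)"
proof -
  \<comment> \<open>The positive gap excludes a zero projection, so the convention for division by
    zero never matters here.\<close>
  have "p \<noteq> 0" using gap eps by auto
  define n where "n = (norm p)\<^sup>2"
  have n: "n > 0" using \<open>p \<noteq> 0\<close> by (simp add: n_def)
  have "(norm p * r)\<^sup>2 \<le> 1" using r by (simp add: power_le_one)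
  then have rn: "r\<^sup>2 \<le> 1 / n" using n by (simp add: n_def field_simps power_mult_distrib)
  have "(norm (u - c *\<^sub>R p))\<^sup>2 = (norm u)\<^sup>2 - 2 * c * (p \<bullet> u) + c\<^sup>2 * n" for c
    unfolding power2_norm_eq_inner n_def
    by (simp add: inner_diff_left inner_diff_right inner_commute power2_eq_square algebra_simps)
  then have "(norm (u - (\<epsilon> / (2 * n)) *\<^sub>R p))\<^sup>2 = (norm u)\<^sup>2 - 2 * (\<epsilon> / (2 * n)) * (p \<bullet> u) + (\<epsilon> / (2 * n))\<^sup>2 * n" .
  also have "\<dots> = (norm u)\<^sup>2 - \<epsilon> * (1 / n) * (p \<bullet> u - \<epsilon> / 4)"
    using n by (simp add: field_simps power2_eq_square)
  also have "\<dots> \<le> (norm u)\<^sup>2 - \<epsilon> * (1 / n) * (\<gamma> - \<epsilon> / 4)"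
    using n eps gap by (simp add: mult_left_mono divide_right_mono)
  also have "\<dots> \<le> (norm u)\<^sup>2 - \<epsilon> * r\<^sup>2 * (\<gamma> - \<epsilon> / 4)"
    using rn eps gap by (simp only: diff_left_mono mult_right_mono mult_left_mono)
  finally show ?thesis by (simp add: n_def)
qed

text \<open>\<open>a < 4/3\<close> expresses that no restart is pending, and
  \<open>a * \<beta> < 1 - \<epsilon>\<close> that the current boundary point is not yet good. The
  second bound is the stronger one for small \<open>\<beta>\<close>.\<close>

lemma gap_bounds:
  fixes a \<beta> \<epsilon> :: real
  assumes a: "0 < a" "a < 4/3" and ab: "a * \<beta> < 1 - \<epsilon>" and eps: "0 < \<epsilon>"
  shows "3 * \<epsilon> / 4 \<le> 1 / a - \<beta>" "3/4 - \<beta> \<le> 1 / a - \<beta>"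
proof -
  have 1: "3/4 \<le> 1 / a" using a by (simp add: field_simps)
  then show "3/4 - \<beta> \<le> 1 / a - \<beta>" by simp
  have "1 / a - \<beta> = (1 - a * \<beta>) * (1 / a)" using a by (simp add: field_simps)
  also have "\<dots> \<ge> \<epsilon> * (3/4)" using 1 ab eps by (intro mult_mono) auto
  finally show "3 * \<epsilon> / 4 \<le> 1 / a - \<beta>" by simp
qed

section \<open>The radial gauge\<close>

text \<open>The condition inside \<open>rhat\<close>. The estimates are made for such real
  \<open>r\<close>, since \<open>rhat\<close> may be infinite.\<close>

definition admissible_radius ::
  "('a::real_normed_vector \<Rightarrow> ereal) \<Rightarrow> 'a set \<Rightarrow> ('a \<Rightarrow> 'b) \<Rightarrow> 'b \<Rightarrow> 'a \<Rightarrow> real \<Rightarrow> real \<Rightarrow> bool" where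
  "admissible_radius f S A b ebar fhat r \<longleftrightarrow>
     (\<forall>x. norm (x - ebar) \<le> r \<and> A x = b \<longrightarrow> x \<in> S \<and> f x \<le> ereal fhat)"

locale radial_problem =
  fixes f :: "'a::euclidean_space \<Rightarrow> ereal" and S :: "'a set"
    and A :: "'a \<Rightarrow> 'b::real_vector" and b :: 'b and ebar :: 'a and fhat :: real
  assumes proper: "\<And>y. f y \<noteq> - \<infinity>" and lsc: "ext_lsc f" and cvx: "ext_convex f"
    and S: "closed S" "convex S" and A: "linear A"
    and ebar: "ebar \<in> interior (S \<inter> dom f)" "A ebar = b" and fhat: "f ebar < ereal fhat"
begin

definition C :: "('a \<times> real) set" where
  "C = {(y, s). y \<in> S \<and> f y \<le> ereal s}"

text \<open>Seen from \<open>(ebar, fhat)\<close>, the functional \<open>(g, \<delta>)\<close> is at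
  most 1 on \<open>C\<close> and equals 1 at \<open>(x', t')\<close>. Only \<open>g\<close> is kept
  because the steps move \<open>x\<close> alone.\<close>

definition gauge_subgradients :: "'a \<Rightarrow> real \<Rightarrow> 'a set" where
  "gauge_subgradients x' t' = {g. \<exists>\<delta>. (\<forall>y s. (y, s) \<in> C \<longrightarrow> g \<bullet> (y - x') + \<delta> * (s - t') \<le> 0) \<and>
     g \<bullet> (ebar - x') + \<delta> * (fhat - t') = -1}"

lemma ebar_interior_S: "ebar \<in> interior S"
  using ebar(1) by auto

lemma base_interior_epi: "(ebar, fhat) \<in> interior (epi f)"
  using ebar(1) by (intro mem_interior_epi proper cvx fhat) auto

lemma base_mem: "(ebar, fhat) \<in> C" "(ebar, fhat) \<in> epi f" "ebar \<in> S"
  using ebar_interior_S interior_subset[of S] fhat by (auto simp: C_def mem_epi_iff)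

text \<open>This admits the convex hull in \<open>G\<close>: mixing the \<open>\<delta>\<close> with
  the same weights preserves both conditions.\<close>

lemma convex_gauge_subgradients: "convex (gauge_subgradients x' t')"
proof (rule convexI)
  fix g h and u v :: real
  assume "g \<in> gauge_subgradients x' t'" "h \<in> gauge_subgradients x' t'" and uv: "0 \<le> u" "0 \<le> v" "u + v = 1"
  then obtain \<delta> \<eta> where
    g: "\<And>y s. (y, s) \<in> C \<Longrightarrow> g \<bullet> (y - x') + \<delta> * (s - t') \<le> 0" "g \<bullet> (ebar - x') + \<delta> * (fhat - t') = -1" and
    h: "\<And>y s. (y, s) \<in> C \<Longrightarrow> h \<bullet> (y - x') + \<eta> * (s - t') \<le> 0" "h \<bullet> (ebar - x') + \<eta> * (fhat - t') = -1"
    unfolding gauge_subgradients_def by blast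
  have split: "(u *\<^sub>R g + v *\<^sub>R h) \<bullet> y + (u * \<delta> + v * \<eta>) * s = u * (g \<bullet> y + \<delta> * s) + v * (h \<bullet> y + \<eta> * s)" for y s
    by (simp add: algebra_simps)
  have "(u *\<^sub>R g + v *\<^sub>R h) \<bullet> (y - x') + (u * \<delta> + v * \<eta>) * (s - t') \<le> 0" if "(y, s) \<in> C" for y s
    unfolding split using g(1)[OF that] h(1)[OF that] uv by (simp add: add_nonpos_nonpos mult_nonneg_nonpos)
  moreover have "(u *\<^sub>R g + v *\<^sub>R h) \<bullet> (ebar - x') + (u * \<delta> + v * \<eta>) * (fhat - t') = -1"
    unfolding split g(2) h(2) using uv by simp
  ultimately show "u *\<^sub>R g + v *\<^sub>R h \<in> gauge_subgradients x' t'"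
    unfolding gauge_subgradients_def by blast
qed

text \<open>\<open>C\<close> projects into \<open>S\<close>, so a rescaled normal to
  \<open>S\<close> serves with \<open>\<delta> = 0\<close>.\<close>

lemma G1_subset: "G1 S ebar x' \<subseteq> gauge_subgradients x' t'"
proof
  fix g assume "g \<in> G1 S ebar x'"
  then obtain v where g: "g = (- 1 / (v \<bullet> (ebar - x'))) *\<^sub>R v" and v: "v \<noteq> 0" "v \<in> normal_cone S x'"
    unfolding G1_def by blast
  define m where "m = v \<bullet> (ebar - x')"
  have m: "m < 0" unfolding m_def using normal_cone_interior_neg[OF ebar_interior_S v(2,1)] .
  have "g \<bullet> (y - x') + 0 * (s - t') \<le> 0" if "(y, s) \<in> C" for y s
  proof -
    have "v \<bullet> (y - x') \<le> 0" using v that by (auto simp: normal_cone_def C_def)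
    then show ?thesis using m unfolding g m_def[symmetric] by (simp add: divide_nonpos_neg)
  qed
  moreover have "g \<bullet> (ebar - x') + 0 * (fhat - t') = -1"
    using m unfolding g by (simp add: m_def)
  ultimately show "g \<in> gauge_subgradients x' t'" unfolding gauge_subgradients_def by blast
qed

text \<open>\<open>C\<close> lies in \<open>epi f\<close>, so a normal to the epigraph, divided by
  minus its value at the base point, serves.\<close>

lemma G2_subset: "G2 f ebar fhat x' t' \<subseteq> gauge_subgradients x' t'"
proof
  fix g assume "g \<in> G2 f ebar fhat x' t'"
  then obtain v d where g: "g = (- 1 / (v \<bullet> (ebar - x') + (fhat - t') * d)) *\<^sub>R v"
    and v: "(v, d) \<noteq> 0" "(v, d) \<in> normal_cone (epi f) (x', t')"
    unfolding G2_def by (auto simp: zero_prod_def)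
  define m where "m = v \<bullet> (ebar - x') + (fhat - t') * d"
  have m: "m < 0" using normal_cone_interior_neg[OF base_interior_epi v(2,1)]
    by (simp add: m_def inner_prod_def mult.commute)
  have g': "g \<bullet> y + (- d / m) * s = - (v \<bullet> y + s * d) / m" for y s
    using m unfolding g m_def[symmetric] by (simp add: field_simps)
  have "g \<bullet> (y - x') + (- d / m) * (s - t') \<le> 0" if "(y, s) \<in> C" for y s
  proof -
    have "v \<bullet> (y - x') + (s - t') * d \<le> 0" 
      using v that by (force simp: normal_cone_def C_def mem_epi_iff[symmetric] inner_prod_def mult.commute)
    then show ?thesis using m unfolding g' by (simp add: divide_nonneg_neg)
  qed
  moreover have "g \<bullet> (ebar - x') + (- d / m) * (fhat - t') = -1"
    unfolding g' m_def[symmetric] using m by simp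
  ultimately show "g \<in> gauge_subgradients x' t'" unfolding gauge_subgradients_def by blast
qed

lemma G_subset: "G f S ebar fhat x' t' \<subseteq> gauge_subgradients x' t'"
  unfolding G_def
  using G1_subset[of x' t'] G2_subset[of x' t']
    hull_minimal[of "G1 S ebar x' \<union> G2 f ebar fhat x' t'" _ convex, OF _ convex_gauge_subgradients, of x' t']
  by (simp split: if_split)

text \<open>The functional \<open>(g, \<delta>)\<close> is \<open>1 / a\<close> at
  \<open>(x, t)\<close>, since it is 1 after scaling by \<open>a\<close>, and at most
  \<open>\<beta>\<close> at the comparison point. Both points have height \<open>t\<close>, so the
  \<open>\<delta>\<close> terms cancel in the difference.\<close>

lemma subgradient_gap:
  assumes g: "g \<in> gauge_subgradients x' t'"
    and z': "x' = ebar + a *\<^sub>R (x - ebar)" "t' = fhat + a * (t - fhat)" "0 < a"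
    and p: "(p, c) \<in> C" and \<beta>: "0 \<le> \<beta>" "t = fhat + \<beta> * (c - fhat)"
  shows "1 / a - \<beta> \<le> g \<bullet> (x - (ebar + \<beta> *\<^sub>R (p - ebar)))"
proof -
  obtain \<delta> where d: "\<And>y s. (y, s) \<in> C \<Longrightarrow> g \<bullet> (y - x') + \<delta> * (s - t') \<le> 0"
    "g \<bullet> (ebar - x') + \<delta> * (fhat - t') = -1"
    using g unfolding gauge_subgradients_def by blast
  have "g \<bullet> (p - ebar) + \<delta> * (c - fhat) \<le> 1"
    using d(1)[OF p] d(2) by (simp add: inner_diff_right algebra_simps)
  then have 1: "\<beta> * (g \<bullet> (p - ebar) + \<delta> * (c - fhat)) \<le> \<beta>"
    using \<beta>(1) mult_left_mono by fastforce
  have "a * (g \<bullet> (x - ebar) + \<delta> * (t - fhat)) = 1"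
    using d(2) unfolding z' by (simp add: inner_diff_right inner_add_right algebra_simps)
  then have "1 / a = g \<bullet> (x - ebar) + \<delta> * (t - fhat)"
    using z'(3) by (simp add: field_simps)
  also have "\<dots> = g \<bullet> (x - (ebar + \<beta> *\<^sub>R (p - ebar))) + \<beta> * (g \<bullet> (p - ebar) + \<delta> * (c - fhat))"
    unfolding \<beta>(2) by (simp add: inner_diff_right inner_add_right algebra_simps)
  finally show ?thesis using 1 by linarith
qed

section \<open>Projection of subgradients onto the kernel of \<open>A\<close>\<close>

lemma subspace_ker: "subspace {z. A z = 0}"
  using A by (rule linear_subspace_kernel)

lemma A_proj_ker [simp]: "A (proj_ker A g) = 0"
  using orth_proj_eq(1)[OF subspace_ker, of g] by (simp add: proj_ker_def)

lemma inner_proj_ker: "A z = 0 \<Longrightarrow> proj_ker A g \<bullet> z = g \<bullet> z"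
  using orth_proj_eq(2)[OF subspace_ker, of z g] by (simp add: proj_ker_def inner_diff_left)

text \<open>The bound 1 on \<open>C\<close> is tested at distance \<open>r\<close> from
  \<open>ebar\<close> in the direction of the projection, at height \<open>fhat\<close>, where the
  \<open>\<delta>\<close> term vanishes.\<close>

lemma norm_proj_subgradient:
  assumes g: "g \<in> gauge_subgradients x' t'" and r: "0 < r" "admissible_radius f S A b ebar fhat r"
  shows "norm (proj_ker A g) * r \<le> 1"
proof (cases "proj_ker A g = 0")
  case False
  obtain \<delta> where d: "\<And>y s. (y, s) \<in> C \<Longrightarrow> g \<bullet> (y - x') + \<delta> * (s - t') \<le> 0"
    "g \<bullet> (ebar - x') + \<delta> * (fhat - t') = -1"
    using g unfolding gauge_subgradients_def by blast
  define p where "p = proj_ker A g"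
  have p: "p \<noteq> 0" "A p = 0" using False by (auto simp: p_def)
  define q where "q = ebar + (r / norm p) *\<^sub>R p"
  have "A q = b" using p ebar(2) by (simp add: q_def linear_add[OF A] linear_cmul[OF A])
  moreover have "norm (q - ebar) \<le> r" using p r by (simp add: q_def)
  ultimately have "(q, fhat) \<in> C" using r(2) by (auto simp: C_def admissible_radius_def)
  then have "g \<bullet> (q - ebar) \<le> 1"
    using d(1)[of q fhat] d(2) by (simp add: inner_diff_right)
  moreover have "g \<bullet> (q - ebar) = (r / norm p) * (p \<bullet> p)"
    using inner_proj_ker[OF p(2), of g] by (simp add: q_def p_def)
  ultimately show ?thesis using p by (simp add: p_def power2_norm_eq_inner[symmetric] power2_eq_square mult.commute)
qed simp

text \<open>The height falls linearly along the ray while feasible values stay at least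
  \<open>m\<close>, so the smaller supremum is finite and \<open>real_of_ereal\<close> is
  faithful.\<close>

lemma line_search:
  assumes x: "A x = b" and t: "t < fhat" and bnd: "\<And>y. y \<in> Feas S A b \<Longrightarrow> ereal m \<le> f y"
  defines "a \<equiv> alpha f S ebar fhat x t"
  shows "0 < a" "(ebar + a *\<^sub>R (x - ebar), fhat + a * (t - fhat)) \<in> C"
proof -
  define w where "w = (x - ebar, t - fhat)"
  define T1 where "T1 = {ereal a | a. ebar + a *\<^sub>R (x - ebar) \<in> S}"
  \<comment> \<open>Written as a ray in the product space, the condition of \<open>alpha2\<close>
    falls under the same ray lemmas as that of \<open>alpha1\<close>.\<close>
  define T2 where "T2 = {ereal a | a. (ebar, fhat) + a *\<^sub>R w \<in> epi f}"
  have a: "a = real_of_ereal (min (Sup T1) (Sup T2))"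
    by (simp add: a_def alpha_def alpha1_def alpha2_def T1_def T2_def w_def mem_epi_iff)
  obtain a1 where a1: "0 < a1" "ereal a1 \<in> T1"
    using ray_interior[OF ebar_interior_S, of "x - ebar"] by (auto simp: T1_def)
  obtain a2 where a2: "0 < a2" "ereal a2 \<in> T2"
    using ray_interior[OF base_interior_epi, of w] by (auto simp: T2_def)
  have "ereal (min a1 a2) \<le> min (Sup T1) (Sup T2)"
    using a1 a2 by (auto simp: min_def intro: Sup_upper order_trans[rotated])
  then have lb: "0 < min (Sup T1) (Sup T2)" using a1 a2
    by (metis ereal_less(2) less_le_trans min_less_iff_conj)
  have mem: "(ebar + d *\<^sub>R (x - ebar), fhat + d * (t - fhat)) \<in> C"
    if d: "0 \<le> d" "ereal d \<le> min (Sup T1) (Sup T2)" for d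
  proof -
    have "ebar + d *\<^sub>R (x - ebar) \<in> S"
      using d S base_mem by (intro ray_mem) (auto simp: T1_def)
    moreover have "(ebar, fhat) + d *\<^sub>R w \<in> epi f"
      using d closed_epi[OF lsc] convex_epi[OF cvx] base_mem by (intro ray_mem) (auto simp: T2_def)
    ultimately show ?thesis by (simp add: C_def w_def mem_epi_iff)
  qed
  have ub: "d \<le> (fhat - m) / (fhat - t)" if "0 \<le> d" "ereal d \<le> min (Sup T1) (Sup T2)" for d
  proof -
    have "A (ebar + d *\<^sub>R (x - ebar)) = b"
      using x ebar(2) by (simp add: linear_add[OF A] linear_cmul[OF A] linear_diff[OF A])
    then have "ereal m \<le> f (ebar + d *\<^sub>R (x - ebar))"
      using bnd mem[OF that] by (simp add: C_def Feas_def)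
    also have "\<dots> \<le> ereal (fhat + d * (t - fhat))" using mem[OF that] by (simp add: C_def)
    finally show ?thesis using t by (simp add: field_simps)
  qed
  have "min (Sup T1) (Sup T2) \<noteq> \<infinity>"
  proof
    assume inf: "min (Sup T1) (Sup T2) = \<infinity>"
    have "max 0 ((fhat - m) / (fhat - t) + 1) \<le> (fhat - m) / (fhat - t)"
      by (rule ub) (simp_all add: inf)
    then show False by linarith
  qed
  then obtain r where r: "min (Sup T1) (Sup T2) = ereal r"
    using lb by (cases "min (Sup T1) (Sup T2)") auto
  then have ar: "a = r" "0 < r" using a lb by auto
  show "0 < a" using ar by simp
  show "(ebar + a *\<^sub>R (x - ebar), fhat + a * (t - fhat)) \<in> C"
    by (rule mem) (use ar r in auto)
qed

text \<open>\<open>ebar\<close> is a convex combination of \<open>p\<close> and the point at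
  distance \<open>r\<close> on the opposite side, where \<open>f\<close> is at most
  \<open>fhat\<close>. This will bound \<open>1 / \<beta> 0\<close>.\<close>

lemma base_gap:
  assumes p: "p \<in> S" "A p = b" "f p = ereal c" and h0: "f ebar = ereal h0"
    and r: "0 < r" "admissible_radius f S A b ebar fhat r"
  shows "fhat - c \<le> (1 + norm (p - ebar) / r) * (fhat - h0)"
proof (cases "p = ebar")
  case True
  then show ?thesis using p h0 by simp
next
  case False
  define d where "d = norm (p - ebar)"
  have d: "d > 0" using False by (simp add: d_def)
  define q where "q = ebar - (r / d) *\<^sub>R (p - ebar)"
  have "norm (q - ebar) \<le> r" using d r by (simp add: q_def) (simp add: d_def)
  moreover have "A q = b" using p ebar(2) by (simp add: q_def linear_cmul[OF A] linear_diff[OF A])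
  ultimately have q: "f q \<le> ereal fhat" using r(2) by (auto simp: admissible_radius_def)
  have rd: "r + d \<noteq> 0" using r d by simp
  have "(r + d) *\<^sub>R ((r / (r + d)) *\<^sub>R p + (d / (r + d)) *\<^sub>R q) = r *\<^sub>R p + d *\<^sub>R q"
    using rd by (simp add: scaleR_add_right)
  also have "\<dots> = (r + d) *\<^sub>R ebar" using d by (simp add: q_def algebra_simps)
  finally have eq: "(r / (r + d)) *\<^sub>R p + (d / (r + d)) *\<^sub>R q = ebar" using rd by simp
  have "f ((r / (r + d)) *\<^sub>R p + (d / (r + d)) *\<^sub>R q) \<le> ereal (r / (r + d)) * f p + ereal (d / (r + d)) * f q"
    using cvx r d rd unfolding ext_convex_def by (auto simp: add_divide_distrib[symmetric])
  also have "\<dots> \<le> ereal (r / (r + d)) * f p + ereal (d / (r + d)) * ereal fhat"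
    using q r d by (intro add_mono ereal_mult_left_mono) auto
  finally have "h0 \<le> r / (r + d) * c + d / (r + d) * fhat" unfolding eq using p h0 by simp
  also have "\<dots> = (r * c + d * fhat) / (r + d)" by (simp add: add_divide_distrib)
  finally have "h0 * (r + d) \<le> r * c + d * fhat" using r d by (simp add: pos_le_divide_eq)
  then show ?thesis using r d by (simp add: d_def[symmetric] field_simps)
qed

section \<open>Analysis of a run\<close>

text \<open>The boundary point lies on the ray of the current iterate at a parameter below 4/3: it
  is 1 at the start and after a restart, otherwise the line search value that failed the
  test.\<close>

lemma run_invariant:
  assumes h0: "f ebar = ereal h0" and bnd: "\<And>y. y \<in> Feas S A b \<Longrightarrow> ereal m \<le> f y"
    and x0: "x 0 = ebar" "t 0 = h0" "x' 0 = ebar" "t' 0 = h0"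
    and xt: "\<And>k. xt k = x k - s k *\<^sub>R proj_ker A (g k)"
    and al: "\<And>k. al k = alpha f S ebar fhat (xt k) (t k)"
    and x': "\<And>k. x' (Suc k) = ebar + al k *\<^sub>R (xt k - ebar)" "\<And>k. t' (Suc k) = fhat + al k * (t k - fhat)"
    and x: "\<And>k. x (Suc k) = (if al k \<ge> 4/3 then x' (Suc k) else xt k)"
      "\<And>k. t (Suc k) = (if al k \<ge> 4/3 then t' (Suc k) else t k)"
  shows "A (x k) = b \<and> t k \<le> h0 \<and> (\<exists>a>0. a < 4/3 \<and> x' k = ebar + a *\<^sub>R (x k - ebar) \<and> t' k = fhat + a * (t k - fhat))
     \<and> (x' k, t' k) \<in> C \<and> A (x' k) = b"
proof (induction k)
  case 0
  have "\<exists>a>0. a < 4/3 \<and> x' 0 = ebar + a *\<^sub>R (x 0 - ebar) \<and> t' 0 = fhat + a * (t 0 - fhat)"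
    by (rule exI[of _ 1]) (simp add: x0)
  then show ?case using x0 ebar(2) base_mem h0 by (simp add: C_def)
next
  case (Suc k)
  have Axt: "A (xt k) = b" using Suc by (simp add: xt linear_diff[OF A] linear_cmul[OF A])
  have h0f: "h0 < fhat" using fhat h0 by simp
  then have tk: "t k < fhat" using Suc by simp
  have al0: "0 < al k" and C: "(x' (Suc k), t' (Suc k)) \<in> C"
    using line_search[OF Axt tk bnd] unfolding al x' by auto
  have Ax': "A (x' (Suc k)) = b"
    using Axt ebar(2) by (simp add: x' linear_add[OF A] linear_cmul[OF A] linear_diff[OF A])
  show ?case
  proof (cases "al k \<ge> 4/3")
    case True
    \<comment> \<open>\<open>t k - fhat\<close> is negative, so scaling by at least 1 cannot raise
      the height.\<close>
    have "al k * (t k - fhat) \<le> 1 * (t k - fhat)" using True tk by (intro mult_right_mono_neg) auto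
    then have "t' (Suc k) \<le> h0" using Suc by (simp add: x')
    moreover have "\<exists>a>0. a < 4/3 \<and> x' (Suc k) = ebar + a *\<^sub>R (x (Suc k) - ebar) \<and> t' (Suc k) = fhat + a * (t (Suc k) - fhat)"
      by (rule exI[of _ 1]) (use True in \<open>simp add: x\<close>)
    ultimately show ?thesis using True C Ax' by (simp add: x)
  next
    case False
    have "\<exists>a>0. a < 4/3 \<and> x' (Suc k) = ebar + a *\<^sub>R (x (Suc k) - ebar) \<and> t' (Suc k) = fhat + a * (t (Suc k) - fhat)"
      by (rule exI[of _ "al k"]) (use False al0 x' in \<open>simp add: x\<close>)
    then show ?thesis using False C Ax' Axt Suc by (simp add: x)
  qed
qed

text \<open>Contrapositive form: while no boundary point is good relative to the value
  \<open>c\<close> of one fixed feasible \<open>p\<close>, the number of iterates is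
  bounded.\<close>

lemma iteration_bound:
  assumes run: "algorithm_A f S A ebar fhat \<epsilon> x t x' t'"
    and eps: "0 < \<epsilon>" "\<epsilon> < 1"
    and bnd: "\<And>y. y \<in> Feas S A b \<Longrightarrow> ereal m \<le> f y"
    and p: "p \<in> Feas S A b" "f p = ereal c"
    and bad: "\<And>k. k \<le> l \<Longrightarrow> ereal (c + \<epsilon> * (fhat - c)) < f (x' k)"
    and r: "0 < r" "admissible_radius f S A b ebar fhat r"
    and D: "\<And>y z. y \<in> level_set f S A b ebar \<Longrightarrow> z \<in> level_set f S A b ebar \<Longrightarrow> norm (y - z) \<le> D"
  shows "real (Suc l) \<le> 6 * (D / r)\<^sup>2 * (1 / \<epsilon>\<^sup>2 + 1 / \<epsilon> * log (4/3) (1 + D / r))"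
proof -
  obtain h0 where h0: "f ebar = ereal h0" using proper[of ebar] fhat by (cases "f ebar") auto
  have h0f: "h0 < fhat" using fhat h0 by simp
  from run obtain g where g: "\<And>k. g k \<in> G f S ebar fhat (x' k) (t' k)" and
    st: "\<And>k. let Pg = proj_ker A (g k);
            xt = x k - (\<epsilon> / (2 * (norm Pg)\<^sup>2)) *\<^sub>R Pg;
            a = alpha f S ebar fhat xt (t k)
        in (x' (Suc k), t' (Suc k)) = pi' f S ebar fhat xt (t k) \<and>
           (x (Suc k), t (Suc k)) =
             (if a \<ge> 4 / 3 then (x' (Suc k), t' (Suc k)) else (xt, t k))"
    unfolding algorithm_A_def by metis
  define P where "P k = proj_ker A (g k)" for k
  define xt where "xt k = x k - (\<epsilon> / (2 * (norm (P k))\<^sup>2)) *\<^sub>R P k" for k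
  define al where "al k = alpha f S ebar fhat (xt k) (t k)" for k
  have x'S: "x' (Suc k) = ebar + al k *\<^sub>R (xt k - ebar)" "t' (Suc k) = fhat + al k * (t k - fhat)" for k
    using st[of k] by (simp_all add: Let_def pi'_def al_def xt_def P_def)
  have xS: "x (Suc k) = (if al k \<ge> 4/3 then x' (Suc k) else xt k)"
      "t (Suc k) = (if al k \<ge> 4/3 then t' (Suc k) else t k)" for k
    using st[of k] unfolding Let_def al_def xt_def P_def by (auto split: if_splits)
  have x0: "x 0 = ebar" "t 0 = h0" "x' 0 = ebar" "t' 0 = h0"
    using run h0 by (auto simp: algorithm_A_def)
  note inv = run_invariant[OF h0 bnd x0 xt_def[unfolded P_def] al_def x'S xS]
  have Ax: "A (x k) = b" and th: "t k \<le> h0" and C: "(x' k, t' k) \<in> C" and Ax': "A (x' k) = b" for k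
    using inv[of k] by blast+
  obtain a where a: "\<And>k. 0 < a k" "\<And>k. a k < 4/3" "\<And>k. x' k = ebar + a k *\<^sub>R (x k - ebar)"
      "\<And>k. t' k = fhat + a k * (t k - fhat)"
    using inv by metis
  have pS: "p \<in> S" "A p = b" using p by (auto simp: Feas_def)
  \<comment> \<open>As \<open>x' 0 = ebar\<close>, failure at \<open>k = 0\<close> forces
    \<open>c < h0\<close>.\<close>
  have h0c: "c + \<epsilon> * (fhat - c) < h0" using bad[of 0] x0 h0 by simp
  have cf: "c < fhat"
  proof -
    have "(1 - \<epsilon>) * c < (1 - \<epsilon>) * fhat" using h0c h0f by (simp add: algebra_simps)
    then show ?thesis using eps by simp
  qed
  have ch: "c < h0" using h0c eps cf mult_pos_pos[of \<epsilon> "fhat - c"] by linarith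
  define H where "H = fhat - c"
  have H: "H > 0" using cf by (simp add: H_def)
  define \<beta> where "\<beta> k = (fhat - t k) / H" for k
  have t\<beta>: "t k = fhat + \<beta> k * (c - fhat)" for k
    using H by (simp add: \<beta>_def H_def field_simps)
  have \<beta>pos: "\<beta> k > 0" for k using th[of k] h0f H by (simp add: \<beta>_def)
  define y where "y k = ebar + \<beta> k *\<^sub>R (p - ebar)" for k
  have t'c: "c + \<epsilon> * H < t' k" if "k \<le> l" for k
  proof -
    have "ereal (c + \<epsilon> * H) < f (x' k)" using bad[OF that] by (simp add: H_def)
    also have "\<dots> \<le> ereal (t' k)" using C by (simp add: C_def)
    finally show ?thesis by simp
  qed
  have ratio: "(fhat - t' k) / H < 1 - \<epsilon>" if "k \<le> l" for k
    using t'c[OF that] H by (simp add: H_def field_simps)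
  have a\<beta>: "a k * \<beta> k < 1 - \<epsilon>" if "k \<le> l" for k
    using ratio[OF that] H by (simp add: a(4) \<beta>_def field_simps)
  have \<beta>Suc: "\<beta> (Suc k) = (if al k \<ge> 4/3 then al k * \<beta> k else \<beta> k)" for k
    by (simp add: \<beta>_def xS x'S field_simps)
  \<comment> \<open>\<open>\<beta>\<close> changes only at a restart, and there it is the normalised
    depth of a boundary point that is not good.\<close>
  have \<beta>1: "\<beta> k < 1" if "k \<le> l" for k
    using that
  proof (induction k)
    case 0
    show ?case using ch H by (simp add: \<beta>_def x0 H_def)
  next
    case (Suc k)
    show ?case
    proof (cases "al k \<ge> 4/3")
      case True
      then have "\<beta> (Suc k) = (fhat - t' (Suc k)) / H" by (simp add: \<beta>_def xS)
      then show ?thesis using ratio[OF Suc.prems] eps by simp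
    qed (use Suc in \<open>simp add: \<beta>Suc\<close>)
  qed
  have lev_p: "p \<in> level_set f S A b ebar" using p ch h0 by (simp add: level_set_def)
  have lev_e: "ebar \<in> level_set f S A b ebar" using base_mem ebar by (simp add: level_set_def Feas_def)
  have lev_y: "y k \<in> level_set f S A b ebar" if "k \<le> l" for k
  proof -
    have b01: "0 \<le> \<beta> k" "\<beta> k \<le> 1" using \<beta>pos[of k] \<beta>1[OF that] by auto
    have yk: "y k = (1 - \<beta> k) *\<^sub>R ebar + \<beta> k *\<^sub>R p" by (simp add: y_def algebra_simps)
    have "y k \<in> S" unfolding yk using S base_mem pS b01 by (intro convexD) auto
    moreover have "A (y k) = b" using pS ebar(2) by (simp add: y_def linear_add[OF A] linear_cmul[OF A] linear_diff[OF A])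
    moreover have "f (y k) \<le> ereal (1 - \<beta> k) * f ebar + ereal (\<beta> k) * f p"
      unfolding yk using cvx b01 unfolding ext_convex_def by force
    moreover have "(1 - \<beta> k) * h0 + \<beta> k * c \<le> h0"
      using b01 ch mult_left_mono[of c h0 "\<beta> k"] by (simp add: algebra_simps)
    ultimately show ?thesis using h0 p by (auto simp: level_set_def Feas_def intro: order_trans)
  qed
  define d where "d k = (norm (x k - y k))\<^sup>2" for k
  define d' where "d' k = (norm (xt k - y k))\<^sup>2" for k
  have lev_d: "d k \<le> D\<^sup>2" if "k \<le> l" "x k \<in> level_set f S A b ebar" for k
    unfolding d_def using D[OF that(2) lev_y[OF that(1)]] by (intro power_mono) auto
  have D0: "0 \<le> D" using D[OF lev_e lev_e] by simp
  have dec: "d' k \<le> d k - \<epsilon> * r\<^sup>2 * ((1 / a k - \<beta> k) - \<epsilon> / 4)" if k: "k \<le> l" for k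
  proof -
    have W: "g k \<in> gauge_subgradients (x' k) (t' k)" using g G_subset by blast
    have "1 / a k - \<beta> k \<le> g k \<bullet> (x k - y k)"
      unfolding y_def using W a(3,4,1) _ _ t\<beta>
      by (rule subgradient_gap) (use \<beta>pos[of k] pS p in \<open>auto simp: C_def\<close>)
    also have "\<dots> = P k \<bullet> (x k - y k)"
    proof -
      have "A (x k - y k) = 0" using Ax lev_y[OF k] by (simp add: linear_diff[OF A] level_set_def Feas_def)
      then show ?thesis using inner_proj_ker by (simp add: P_def)
    qed
    finally have gap: "1 / a k - \<beta> k \<le> P k \<bullet> (x k - y k)" .
    have "norm (P k) * r \<le> 1" unfolding P_def using W r by (rule norm_proj_subgradient)
    from step_decrease[OF eps(1) r(1) this gap gap_bounds(1)[OF a(1,2) a\<beta>[OF k] eps(1)]]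
    show ?thesis by (simp add: d_def d'_def xt_def algebra_simps)
  qed
  \<comment> \<open>\<open>\<kappa>1\<close> and \<open>\<kappa>2\<close> are reciprocals of the
    guaranteed decreases. Since \<open>3 * \<kappa>2 = 6 / (\<epsilon>^2 * r^2)\<close>, both terms
    carry the factor 6.\<close>
  define \<kappa>1 where "\<kappa>1 = 6 / (\<epsilon> * r\<^sup>2)"
  define \<kappa>2 where "\<kappa>2 = 2 / (\<epsilon>\<^sup>2 * r\<^sup>2)"
  have er: "0 < \<epsilon> * r\<^sup>2" using eps r by simp
  have "real (Suc l) \<le> D\<^sup>2 * (\<kappa>1 * log (4/3) (1 / \<beta> 0) + 3 * \<kappa>2)"
  proof (rule stage_count[where d = d and d' = d'])
    show "0 \<le> D\<^sup>2" "0 < \<kappa>1" "0 < \<kappa>2" using eps r by (auto simp: \<kappa>1_def \<kappa>2_def)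
    show "0 < \<beta> 0" "\<And>k. k \<le> l \<Longrightarrow> \<beta> k < 1" by (fact \<beta>pos, fact \<beta>1)
    show "d 0 \<le> D\<^sup>2" using lev_e by (intro lev_d) (auto simp: x0)
    show "\<And>k. k \<le> l \<Longrightarrow> 0 \<le> d' k" by (simp add: d'_def)
    show "1 \<le> \<kappa>1 * (d k - d' k)" if k: "k \<le> l" "\<beta> k \<le> 1/2" for k
    proof -
      \<comment> \<open>The gap is at least 1/4, and \<open>\<epsilon> / 4\<close> is at most a
        third of it, leaving two thirds of 1/4.\<close>
      have "1/6 \<le> (1 / a k - \<beta> k) - \<epsilon> / 4"
        using gap_bounds[OF a(1,2) a\<beta>[OF k(1)] eps(1)] k(2) by linarith
      then have "\<epsilon> * r\<^sup>2 * (1/6) \<le> \<epsilon> * r\<^sup>2 * ((1 / a k - \<beta> k) - \<epsilon> / 4)" using er by (intro mult_left_mono) auto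
      then have "\<epsilon> * r\<^sup>2 / 6 \<le> d k - d' k" using dec[OF k(1)] by simp
      then show ?thesis using eps r by (simp add: \<kappa>1_def field_simps)
    qed
    show "1 \<le> \<kappa>2 * (d k - d' k)" if k: "k \<le> l" for k
    proof -
      have "\<epsilon> / 2 \<le> (1 / a k - \<beta> k) - \<epsilon> / 4"
        using gap_bounds[OF a(1,2) a\<beta>[OF k] eps(1)] by linarith
      then have "\<epsilon> * r\<^sup>2 * (\<epsilon> / 2) \<le> \<epsilon> * r\<^sup>2 * ((1 / a k - \<beta> k) - \<epsilon> / 4)" using er by (intro mult_left_mono) auto
      moreover have "\<epsilon> * r\<^sup>2 * (\<epsilon> / 2) = \<epsilon>\<^sup>2 * r\<^sup>2 / 2" by (simp add: power2_eq_square)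
      ultimately have "\<epsilon>\<^sup>2 * r\<^sup>2 / 2 \<le> d k - d' k" using dec[OF k] by linarith
      then show ?thesis using eps r by (simp add: \<kappa>2_def field_simps)
    qed
    show "\<beta> (Suc k) = \<beta> k \<and> d (Suc k) = d' k \<or> 4/3 * \<beta> k \<le> \<beta> (Suc k) \<and> d (Suc k) \<le> D\<^sup>2" if k: "k < l" for k
    proof (cases "al k \<ge> 4/3")
      case False
      then have "\<beta> (Suc k) = \<beta> k" by (simp add: \<beta>Suc)
      \<comment> \<open>The comparison point depends on \<open>k\<close> only through
        \<open>\<beta> k\<close>, so it stays fixed between restarts.\<close>
      moreover from this have "d (Suc k) = d' k" using False by (simp add: d_def d'_def y_def xS)
      ultimately show ?thesis by simp
    next
      case True
      \<comment> \<open>A restart lands in the level set, which contains the new comparison point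
        too, so \<open>D\<close> bounds their distance.\<close>
      have "f (x' (Suc k)) \<le> ereal (t' (Suc k))" using C by (simp add: C_def)
      also have "\<dots> \<le> f ebar" using th[of "Suc k"] True h0 by (simp add: xS)
      finally have "x (Suc k) \<in> level_set f S A b ebar"
        using True C[of "Suc k"] Ax'[of "Suc k"] by (simp add: level_set_def Feas_def xS C_def)
      then have "d (Suc k) \<le> D\<^sup>2" using k by (intro lev_d) auto
      moreover have "4/3 * \<beta> k \<le> \<beta> (Suc k)" using True \<beta>pos[of k] by (simp add: \<beta>Suc)
      ultimately show ?thesis by simp
    qed
  qed
  also have "\<dots> \<le> D\<^sup>2 * (\<kappa>1 * log (4/3) (1 + D / r) + 3 * \<kappa>2)"
  proof -
    have "H \<le> (1 + norm (p - ebar) / r) * (fhat - h0)"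
      unfolding H_def by (rule base_gap[OF pS p(2) h0 r])
    also have "\<dots> \<le> (1 + D / r) * (fhat - h0)"
      using D[OF lev_p lev_e] r h0f by (intro mult_right_mono add_left_mono divide_right_mono) auto
    finally have "1 / \<beta> 0 \<le> 1 + D / r" using h0f H by (simp add: \<beta>_def x0 field_simps)
    then have "log (4/3) (1 / \<beta> 0) \<le> log (4/3) (1 + D / r)"
      using \<beta>pos[of 0] D0 r by (subst log_le_cancel_iff) (auto simp: add_pos_nonneg)
    then show ?thesis using er by (intro mult_left_mono add_right_mono) (auto simp: \<kappa>1_def)
  qed
  also have "\<dots> = 6 * (D / r)\<^sup>2 * (1 / \<epsilon>\<^sup>2 + 1 / \<epsilon> * log (4/3) (1 + D / r))"
    using eps r by (simp add: \<kappa>1_def \<kappa>2_def field_simps)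
  finally show ?thesis .
qed

section \<open>Positive admissible radii and their limit \<open>rhat\<close>\<close>

lemma admissible_radius_pos: "\<exists>r>0. admissible_radius f S A b ebar fhat r"
proof -
  have "((\<lambda>y. (y, fhat)) \<longlongrightarrow> (ebar, fhat)) (nhds ebar)"
    by (intro tendsto_Pair filterlim_ident tendsto_const)
  then have "\<forall>\<^sub>F y in nhds ebar. (y, fhat) \<in> interior (epi f)"
    using base_interior_epi by (intro topological_tendstoD) auto
  moreover have "\<forall>\<^sub>F y in nhds ebar. y \<in> interior S"
    using ebar_interior_S by (intro eventually_nhds_in_open) auto
  ultimately have "\<forall>\<^sub>F y in nhds ebar. y \<in> S \<and> f y \<le> ereal fhat"
  proof eventually_elim
    case (elim y)
    then show ?case using interior_subset[of S] interior_subset[of "epi f"] mem_epi_iff[of y fhat f] by blast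
  qed
  then obtain d where d: "d > 0" "\<And>y. dist y ebar < d \<Longrightarrow> y \<in> S \<and> f y \<le> ereal fhat"
    unfolding eventually_nhds_metric by blast
  have "admissible_radius f S A b ebar fhat (d / 2)"
    unfolding admissible_radius_def using d by (auto simp: dist_norm)
  then show ?thesis using d(1) by (intro exI[of _ "d / 2"]) auto
qed

lemma admissible_below_rhat:
  assumes "ereal r < rhat f S A b ebar fhat"
  shows "admissible_radius f S A b ebar fhat r"
proof -
  obtain u where u: "r < u" "admissible_radius f S A b ebar fhat u"
    using assms unfolding rhat_def less_Sup_iff by (auto simp: admissible_radius_def)
  then show ?thesis by (auto simp: admissible_radius_def)
qed

lemma rhat_pos: "0 < rhat f S A b ebar fhat"
proof -
  obtain r where "r > 0" "admissible_radius f S A b ebar fhat r" using admissible_radius_pos by blast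
  then have "ereal r \<le> rhat f S A b ebar fhat"
    unfolding rhat_def by (intro Sup_upper) (auto simp: admissible_radius_def)
  with \<open>r > 0\<close> show ?thesis by (meson ereal_less(2) less_le_trans)
qed

text \<open>One filter serves both cases: left neighbourhoods of a finite \<open>rhat\<close>, or
  \<open>at_top\<close> with limit 0 for an infinite one. Bounds in \<open>D / r\<close> then pass
  to the limit.\<close>

lemma rhat_limit:
  assumes "0 \<le> (D::real)"
  obtains F where "F \<noteq> bot" "((\<lambda>r. D / r) \<longlongrightarrow> real_of_ereal (ereal D / rhat f S A b ebar fhat)) F"
    "\<forall>\<^sub>F r in F. 0 < r \<and> admissible_radius f S A b ebar fhat r"
proof (cases "rhat f S A b ebar fhat")
  case (real \<rho>)
  then have \<rho>: "\<rho> > 0" using rhat_pos by simp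
  show thesis
  proof (rule that[of "at_left \<rho>"])
    show "((\<lambda>r. D / r) \<longlongrightarrow> real_of_ereal (ereal D / rhat f S A b ebar fhat)) (at_left \<rho>)"
      using \<rho> real by (auto intro!: tendsto_eq_intros)
    show "\<forall>\<^sub>F r in at_left \<rho>. 0 < r \<and> admissible_radius f S A b ebar fhat r"
      using eventually_at_left_real[OF \<rho>] real admissible_below_rhat by (auto elim!: eventually_mono)
  qed simp
next
  case PInf
  show thesis
  proof (rule that[of at_top])
    show "((\<lambda>r. D / r) \<longlongrightarrow> real_of_ereal (ereal D / rhat f S A b ebar fhat)) at_top"
      using tendsto_divide_0[OF tendsto_const filterlim_at_top_imp_at_infinity[OF filterlim_ident], of D] PInf by simp
    show "\<forall>\<^sub>F r in at_top. 0 < r \<and> admissible_radius f S A b ebar fhat r"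
      using eventually_gt_at_top[of "0::real"] PInf admissible_below_rhat by (auto elim!: eventually_mono)
  qed simp
qed (use rhat_pos in simp)

end

section \<open>From near-minimisers and smaller radii to the exact bound\<close>

theorem theorem1p1:
  fixes f :: "'a::euclidean_space \<Rightarrow> ereal"
    and S :: "'a set"
    and A :: "'a \<Rightarrow> 'b::real_vector"
    and b :: 'b
    and ebar :: 'a
    and fhat eps :: real
    and x x' :: "nat \<Rightarrow> 'a"
    and t t' :: "nat \<Rightarrow> real"
    and l :: nat
  assumes f_proper: "\<And>y. f y \<noteq> - \<infinity>"
    and f_lsc: "ext_lsc f"
    and f_convex: "ext_convex f"
    and S: "closed S" "convex S" "interior S \<noteq> {}"
    and A: "linear A"
    and b: "b \<in> range A"
    and ebar: "ebar \<in> interior (S \<inter> dom f)" "A ebar = b"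
    and level_bounded: "bounded (level_set f S A b ebar)"
    and fhat: "ereal fhat > f ebar"
    and eps: "0 < eps" "eps < 1"
    and run: "algorithm_A f S A ebar fhat eps x t x' t'"
    and l: "let R = real_of_ereal (ereal (diameter (level_set f S A b ebar)) / rhat f S A b ebar fhat)
            in real l \<ge> 8 * R\<^sup>2 * (1 / eps\<^sup>2 + 1 / eps * log (4 / 3) (1 + R))"
  shows "(MIN k\<in>{..l}. (f (x' k) - opt_value f S A b) / (ereal fhat - opt_value f S A b)) \<le> ereal eps"
proof (rule ccontr)
  interpret radial_problem f S A b ebar fhat
    using f_proper f_lsc f_convex S(1,2) A ebar fhat by (rule radial_problem.intro)
  define v where "v = opt_value f S A b"
  define D where "D = diameter (level_set f S A b ebar)"
  define R where "R = real_of_ereal (ereal D / rhat f S A b ebar fhat)"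
  assume "\<not> ?thesis"
  then have bad: "ereal eps < (f (x' k) - v) / (ereal fhat - v)" if "k \<le> l" for k
    using that by (auto simp: v_def not_le)
  have D0: "0 \<le> D" using level_bounded by (simp add: D_def diameter_ge_0)
  have R0: "0 \<le> R" using D0 rhat_pos unfolding R_def
    by (intro real_of_ereal_pos) (simp add: zero_ereal_def[symmetric])
  have ve: "v \<le> f ebar" unfolding v_def opt_value_def using base_mem ebar by (intro INF_lower) (auto simp: Feas_def)
  then have vf: "v < ereal fhat" using fhat by simp
  \<comment> \<open>For \<open>v = -\<infinity>\<close> the quotient is the junk value \<open>\<infinity> / \<infinity> = 0\<close>.\<close>
  have "v \<noteq> -\<infinity>" using bad[of 0] eps by auto
  then obtain m where m: "v = ereal m" using vf by (cases v) auto
  have mf: "m < fhat" using vf m by simp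
  have bnd: "ereal m \<le> f y" if "y \<in> Feas S A b" for y
    unfolding m[symmetric] v_def opt_value_def using that by (rule INF_lower)
  have bad': "ereal (m + eps * (fhat - m)) < f (x' k)" if k: "k \<le> l" for k
  proof (cases "f (x' k)")
    case (real h)
    then have "eps < (h - m) / (fhat - m)" using bad[OF k] m mf by simp
    then show ?thesis using real mf by (simp add: field_simps)
  qed (use f_proper in auto)
  \<comment> \<open>Finitely many strict inequalities share a slack \<open>e\<close>, which allows a
    near-minimiser \<open>p\<close> to replace the optimal value.\<close>
  have "\<exists>e>0. \<forall>k\<le>l. ereal (m + e + eps * (fhat - m)) < f (x' k)"
  proof -
    have "\<forall>\<^sub>F e in at_right 0. \<forall>k\<in>{..l}. ereal (m + e + eps * (fhat - m)) < f (x' k)"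
    proof (intro eventually_ball_finite ballI)
      fix k assume "k \<in> {..l}"
      moreover have "((\<lambda>e. ereal (m + e + eps * (fhat - m))) \<longlongrightarrow> ereal (m + 0 + eps * (fhat - m))) (at_right 0)"
        by (intro tendsto_intros)
      ultimately show "\<forall>\<^sub>F e in at_right 0. ereal (m + e + eps * (fhat - m)) < f (x' k)"
        using bad'[of k] by (intro order_tendstoD(2)) auto
    qed simp
    then have "\<forall>\<^sub>F e in at_right 0. 0 < e \<and> (\<forall>k\<in>{..l}. ereal (m + e + eps * (fhat - m)) < f (x' k))"
      using eventually_at_right_less by (rule eventually_conj[rotated])
    then show ?thesis using eventually_happens'[OF trivial_limit_at_right_real] by fastforce
  qed
  then obtain e where e: "e > 0" "\<And>k. k \<le> l \<Longrightarrow> ereal (m + e + eps * (fhat - m)) < f (x' k)" by blast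
  have "(INF y\<in>Feas S A b. f y) < ereal (m + e)" using m e(1) by (simp add: v_def opt_value_def)
  then obtain p where p: "p \<in> Feas S A b" "f p < ereal (m + e)" by (auto simp: INF_less_iff)
  obtain c where c: "f p = ereal c" using p f_proper[of p] by (cases "f p") auto
  have cm: "c < m + e" "m \<le> c" using p c bnd[OF p(1)] by auto
  have bad2: "ereal (c + eps * (fhat - c)) < f (x' k)" if "k \<le> l" for k
  proof -
    \<comment> \<open>Passing from \<open>m\<close> to \<open>c\<close> costs less than
      \<open>e\<close> in the first summand and can only shrink the second.\<close>
    have "eps * (fhat - c) \<le> eps * (fhat - m)" using cm eps by (intro mult_left_mono) auto
    then have "ereal (c + eps * (fhat - c)) \<le> ereal (m + e + eps * (fhat - m))" using cm by simp
    also have "\<dots> < f (x' k)" using e(2)[OF that] .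
    finally show ?thesis .
  qed
  have DD: "norm (y - z) \<le> D" if "y \<in> level_set f S A b ebar" "z \<in> level_set f S A b ebar" for y z
    using diameter_bounded_bound[OF level_bounded that] by (simp add: D_def dist_norm)
  define \<phi> where "\<phi> u = 6 * u\<^sup>2 * (1 / eps\<^sup>2 + 1 / eps * log (4/3) (1 + u))" for u
  obtain F where F: "F \<noteq> bot" "((\<lambda>r. D / r) \<longlongrightarrow> R) F"
    "\<forall>\<^sub>F r in F. 0 < r \<and> admissible_radius f S A b ebar fhat r"
    using rhat_limit[OF D0] unfolding R_def by blast
  have "((\<lambda>r. \<phi> (D / r)) \<longlongrightarrow> \<phi> R) F"
    unfolding \<phi>_def using R0 by (intro tendsto_intros F(2)) auto
  moreover have "\<forall>\<^sub>F r in F. real (Suc l) \<le> \<phi> (D / r)"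
    using F(3) by eventually_elim
      (use iteration_bound[OF run eps bnd p(1) c bad2 _ _ DD] in \<open>auto simp: \<phi>_def\<close>)
  ultimately have "real (Suc l) \<le> \<phi> R" using F(1) by (intro tendsto_lowerbound)
  also have "\<dots> \<le> 8 * R\<^sup>2 * (1 / eps\<^sup>2 + 1 / eps * log (4/3) (1 + R))"
    unfolding \<phi>_def using R0 eps by (intro mult_right_mono add_nonneg_nonneg mult_nonneg_nonneg) auto
  \<comment> \<open>The contradiction is \<open>Suc l \<le> l\<close>: the indices from 0 to
    \<open>l\<close> give \<open>Suc l\<close> bad iterates.\<close>
  also have "\<dots> \<le> real l" using l by (simp add: R_def D_def Let_def)
  finally show False by simp
qed

end
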